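(* Let $G$ be a graph. Then, for every non-decreasing sequence $S=(a_1,a_2,\ldots)$ of positive integers, $\chi_S''(G)\geq \max\{\chi_S(G),\chi_S'(G)\}$.
   Context: All graphs are simple and undirected. For vertices $u,v$ of $G$, $d(u,v)$ is the usual shortest-path distance (infinite if $u,v$ lie in different components). For a vertex $u$ and an edge $ab$, $d(u,ab)=d(ab,u)=\min\{d(u,a),d(u,b)\}+1$. For two distinct edges $ab,cd$, $d(ab,cd)=\min\{d(a,c),d(a,d),d(b,c),d(b,d)\}+1$. Let $S=(a_1,a_2,\ldots)$ be a non-decreasing infinite sequence of positive integers. An $S$-packing coloring of $G$ using $k$ colors is a map $c:V(G)\to\{1,\ldots,k\}$ such that any two distinct vertices $u,v$ with $c(u)=c(v)=i$ satisfy $d(u,v)>a_i$; $\chi_S(G)$ is the smallest $k$ for which one exists. An $S$-packing edge-coloring of $G$ using $k$ colors is a map $c:E(G)\to\{1,\ldots,k\}$ such that any two distinct edges $e,f$ with $c(e)=c(f)=i$ satisfy $d(e,f)>a_i$; $\chi_S'(G)$ is the smallest $k$ for which one exists. An $S$-packing total coloring of $G$ using $k$ colors is a map $c:V(G)\cup E(G)\to\{1,\ldots,k\}$ such that any two distinct elements $A,B\in V(G)\cup E(G)$ with $c(A)=c(B)=i$ satisfy $d(A,B)>a_i$; $\chi_S''(G)$ is the smallest $k$ for which one exists. If no such $k$ exists, the corresponding invariant is taken to be $\infty$. *)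

theory Defs
  imports Main "HOL-Library.FuncSet" "HOL-Library.Extended_Nat"
begin

text \<open>Graphs need not be finite; \<open>V\<close> may be empty.\<close>

definition simple_graph :: "'a set \<Rightarrow> 'a set set \<Rightarrow> bool" where
  "simple_graph V E \<longleftrightarrow> (\<forall>e\<in>E. e \<subseteq> V \<and> card e = 2)"

definition is_path :: "'a set \<Rightarrow> 'a set set \<Rightarrow> 'a \<Rightarrow> 'a list \<Rightarrow> 'a \<Rightarrow> bool" where
  "is_path V E u p v \<longleftrightarrow>
     p \<noteq> [] \<and> hd p = u \<and> last p = v \<and> set p \<subseteq> V \<and> distinct p \<and>
     successively (\<lambda>x y. {x, y} \<in> E) p"

text \<open>The infimum of the empty set of extended naturals is \<open>\<infinity>\<close>, so vertices in different
  components are at distance \<open>\<infinity>\<close>.\<close>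

definition vertex_dist :: "'a set \<Rightarrow> 'a set set \<Rightarrow> 'a \<Rightarrow> 'a \<Rightarrow> enat" where
  "vertex_dist V E u v = Inf {enat (length p - 1) | p. is_path V E u p v}"

definition vertex_edge_dist :: "'a set \<Rightarrow> 'a set set \<Rightarrow> 'a \<Rightarrow> 'a set \<Rightarrow> enat" where
  "vertex_edge_dist V E u e = (MIN x\<in>e. vertex_dist V E u x) + 1"

text \<open>Only meaningful for distinct edges.\<close>

definition edge_dist :: "'a set \<Rightarrow> 'a set set \<Rightarrow> 'a set \<Rightarrow> 'a set \<Rightarrow> enat" where
  "edge_dist V E e f = (MIN (x, y)\<in>e \<times> f. vertex_dist V E x y) + 1"

text \<open>Elements of \<open>V \<union> E\<close> are encoded in the disjoint sum \<open>V <+> E\<close>.\<close>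

fun total_dist :: "'a set \<Rightarrow> 'a set set \<Rightarrow> 'a + 'a set \<Rightarrow> 'a + 'a set \<Rightarrow> enat" where
  "total_dist V E (Inl u) (Inl v) = vertex_dist V E u v"
| "total_dist V E (Inl u) (Inr e) = vertex_edge_dist V E u e"
| "total_dist V E (Inr e) (Inl u) = vertex_edge_dist V E u e"
| "total_dist V E (Inr e) (Inr f) = edge_dist V E e f"

text \<open>A sequence \<open>(a\<^sub>1, a\<^sub>2, \<dots>)\<close> is a function on \<open>nat\<close> whose value at \<open>0\<close> is irrelevant.\<close>

definition packing_sequence :: "(nat \<Rightarrow> nat) \<Rightarrow> bool" where
  "packing_sequence S \<longleftrightarrow> (\<forall>i\<ge>1. 0 < S i) \<and> mono_on {1..} S"

text \<open>The three kinds of coloring differ only in the set \<open>X\<close> of colored objects and the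
  distance \<open>d\<close> between them.\<close>

definition is_packing_coloring ::
    "'b set \<Rightarrow> ('b \<Rightarrow> 'b \<Rightarrow> enat) \<Rightarrow> (nat \<Rightarrow> nat) \<Rightarrow> nat \<Rightarrow> ('b \<Rightarrow> nat) \<Rightarrow> bool" where
  "is_packing_coloring X d S k c \<longleftrightarrow>
     c \<in> X \<rightarrow> {1..k} \<and>
     (\<forall>x\<in>X. \<forall>y\<in>X. \<forall>i. x \<noteq> y \<and> c x = i \<and> c y = i \<longrightarrow> d x y > enat (S i))"

definition packing_number ::
    "'b set \<Rightarrow> ('b \<Rightarrow> 'b \<Rightarrow> enat) \<Rightarrow> (nat \<Rightarrow> nat) \<Rightarrow> enat" where
  "packing_number X d S = Inf {enat k | k. \<exists>c. is_packing_coloring X d S k c}"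

definition chi_vertex :: "(nat \<Rightarrow> nat) \<Rightarrow> 'a set \<Rightarrow> 'a set set \<Rightarrow> enat" where
  "chi_vertex S V E = packing_number V (vertex_dist V E) S"

definition chi_edge :: "(nat \<Rightarrow> nat) \<Rightarrow> 'a set \<Rightarrow> 'a set set \<Rightarrow> enat" where
  "chi_edge S V E = packing_number E (edge_dist V E) S"

definition chi_total :: "(nat \<Rightarrow> nat) \<Rightarrow> 'a set \<Rightarrow> 'a set set \<Rightarrow> enat" where
  "chi_total S V E = packing_number (V <+> E) (total_dist V E) S"

end

theory Submission
  imports Defs
begin

text \<open>Restricting an \<open>S\<close>-packing total coloring to the vertices, or to the edges, uses no new
  color and leaves the distances unchanged, because the total distance of two vertices is their
  vertex distance and that of two edges is their edge distance. Both restrictions are instances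
  of pulling a packing coloring back along an injection under which distances do not grow
  (\<open>packing_number_le_of_inj\<close>), applied to \<open>Inl\<close> and \<open>Inr\<close>. The infinite case
  needs no separate treatment: the infimum defining the total number is then taken over the empty
  set.\<close>

text \<open>Injectivity matters because the packing condition speaks only of distinct objects: if two
  distinct objects had the same image, the coloring of the target would say nothing about their
  distance.\<close>

lemma is_packing_coloring_comp:
  assumes "is_packing_coloring X d S k c"
    and "f \<in> Y \<rightarrow> X" and "inj_on f Y"
    and "\<And>x y. x \<in> Y \<Longrightarrow> y \<in> Y \<Longrightarrow> d (f x) (f y) \<le> d' x y"
  shows "is_packing_coloring Y d' S k (c \<circ> f)"
  unfolding is_packing_coloring_def
proof (intro conjI ballI allI impI)
  show "c \<circ> f \<in> Y \<rightarrow> {1..k}"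
    using assms(1,2) by (auto simp: is_packing_coloring_def)
next
  fix x y i
  assume xy: "x \<in> Y" "y \<in> Y" and *: "x \<noteq> y \<and> (c \<circ> f) x = i \<and> (c \<circ> f) y = i"
  have "f x \<noteq> f y"
    using * xy assms(3) by (auto dest: inj_onD)
  moreover have "f x \<in> X" "f y \<in> X"
    using xy assms(2) by auto
  ultimately have "enat (S i) < d (f x) (f y)"
    using * assms(1) unfolding is_packing_coloring_def comp_def by blast
  also have "\<dots> \<le> d' x y"
    using assms(4) xy by blast
  finally show "enat (S i) < d' x y" .
qed

lemma packing_number_le_of_inj:
  assumes "f \<in> Y \<rightarrow> X" and "inj_on f Y"
    and "\<And>x y. x \<in> Y \<Longrightarrow> y \<in> Y \<Longrightarrow> d (f x) (f y) \<le> d' x y"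
  shows "packing_number Y d' S \<le> packing_number X d S"
proof -
  have "is_packing_coloring Y d' S k (c \<circ> f)" if "is_packing_coloring X d S k c" for k c
    using that assms by (rule is_packing_coloring_comp)
  then show ?thesis
    unfolding packing_number_def by (intro Inf_superset_mono) blast
qed

theorem mainTheorem1:
  fixes V :: "'a set" and E :: "'a set set" and S :: "nat \<Rightarrow> nat"
  assumes "simple_graph V E"
    and "packing_sequence S"
  shows "chi_total S V E \<ge> max (chi_vertex S V E) (chi_edge S V E)"
proof (rule max.boundedI)
  show "chi_vertex S V E \<le> chi_total S V E"
    unfolding chi_vertex_def chi_total_def
    by (rule packing_number_le_of_inj[where f = Inl]) auto
  show "chi_edge S V E \<le> chi_total S V E"
    unfolding chi_edge_def chi_total_def
    by (rule packing_number_le_of_inj[where f = Inr]) auto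
qed

end
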